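(* Let $\mathcal{L}\subseteq\{+,-,0\}^E$ be the set of covectors of an oriented matroid on a finite ground set $E$ with set of topes $\mathcal{T}$, and let $R\in\mathcal{T}$. Let $S^+,S^-\subseteq E$ be disjoint with $S^+\cup S^-\neq\emptyset$, and suppose the supertope $\mathcal{T}(S^+,S^-)$ is nonempty. Then $\mathcal{T}(S^+,S^-)$, considered as a subposet of the tope poset $\mathcal{T}_R$ with base tope $R$, is contractible.
   Context: Oriented matroids are given by their covector sets (standard covector axioms). Covectors are ordered componentwise by $0<+$, $0<-$; topes are the maximal covectors. For topes $P,Q$, $\mathrm{Sep}(P,Q)=\{e\in E\mid P_e=-Q_e\neq 0\}$. The tope poset $\mathcal{T}_R$ is $\mathcal{T}$ with the partial order $P\preceq_R Q$ iff $\mathrm{Sep}(R,P)\subseteq \mathrm{Sep}(R,Q)$. For disjoint $S^+,S^-\subseteq E$, the supertope is $\mathcal{T}(S^+,S^-)=\{T\in\mathcal{T}\mid T_f=+\text{ for all }f\in S^+\text{ and }T_f=-\text{ for all }f\in S^-\}$. A poset is called contractible if the geometric realization of its order complex (the simplicial complex of its finite chains) is contractible. *)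

theory Defs
  imports "HOL-Analysis.Analysis"
begin

section \<open>Sign vectors\<close>

datatype sign = Zero | Pos | Neg

text \<open>
  The order on signs is \<open>0 < +\<close>, \<open>0 < -\<close>, with \<open>+\<close> and \<open>-\<close> incomparable. The library instances for
  functions then supply the componentwise order and componentwise negation of sign vectors.
\<close>

instantiation sign :: "{order, uminus}"
begin

definition less_eq_sign :: "sign \<Rightarrow> sign \<Rightarrow> bool" where
  "s \<le> t \<longleftrightarrow> s = Zero \<or> s = t"

definition less_sign :: "sign \<Rightarrow> sign \<Rightarrow> bool" where
  "s < t \<longleftrightarrow> s = Zero \<and> t \<noteq> Zero"

definition uminus_sign :: "sign \<Rightarrow> sign" where
  "- s = (case s of Zero \<Rightarrow> Zero | Pos \<Rightarrow> Neg | Neg \<Rightarrow> Pos)"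

instance
  by standard (auto simp: less_eq_sign_def less_sign_def)

end

definition Sep :: "('e \<Rightarrow> sign) \<Rightarrow> ('e \<Rightarrow> sign) \<Rightarrow> 'e set" where
  "Sep X Y = {e. X e = - Y e \<and> X e \<noteq> Zero}"

definition compose_sv :: "('e \<Rightarrow> sign) \<Rightarrow> ('e \<Rightarrow> sign) \<Rightarrow> 'e \<Rightarrow> sign" where
  "compose_sv X Y = (\<lambda>e. if X e \<noteq> Zero then X e else Y e)"


section \<open>Oriented matroids, topes and supertopes\<close>

text \<open>
  An element of \<open>{+,-,0}\<^sup>E\<close> is represented by a function on the whole type that is \<open>Zero\<close> outside \<open>E\<close>.
\<close>

locale oriented_matroid =
  fixes E :: "'e set" and L :: "('e \<Rightarrow> sign) set"
  assumes finite_ground: "finite E"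
    and covector_outside: "X \<in> L \<Longrightarrow> e \<notin> E \<Longrightarrow> X e = Zero"
    and zero_covector: "(\<lambda>_. Zero) \<in> L"
    and symmetry: "X \<in> L \<Longrightarrow> - X \<in> L"
    and composition: "X \<in> L \<Longrightarrow> Y \<in> L \<Longrightarrow> compose_sv X Y \<in> L"
    and elimination: "X \<in> L \<Longrightarrow> Y \<in> L \<Longrightarrow> e \<in> Sep X Y \<Longrightarrow>
      \<exists>Z\<in>L. Z e = Zero \<and>
        (\<forall>f\<in>E - Sep X Y. Z f = compose_sv X Y f \<and> Z f = compose_sv Y X f)"

definition topes :: "('e \<Rightarrow> sign) set \<Rightarrow> ('e \<Rightarrow> sign) set" where
  "topes L = {T \<in> L. \<forall>X\<in>L. T \<le> X \<longrightarrow> X = T}"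

definition tope_poset :: "('e \<Rightarrow> sign) set \<Rightarrow> ('e \<Rightarrow> sign) \<Rightarrow> ('e \<Rightarrow> sign) rel" where
  "tope_poset L R = {(P, Q). P \<in> topes L \<and> Q \<in> topes L \<and> Sep R P \<subseteq> Sep R Q}"

definition supertope :: "('e \<Rightarrow> sign) set \<Rightarrow> 'e set \<Rightarrow> 'e set \<Rightarrow> ('e \<Rightarrow> sign) set" where
  "supertope L Sp Sm = {T \<in> topes L. (\<forall>f\<in>Sp. T f = Pos) \<and> (\<forall>f\<in>Sm. T f = Neg)}"

context oriented_matroid
begin

lemma topes_same_support:
  assumes "P \<in> topes L" "Q \<in> topes L"
  shows "P e = Zero \<longleftrightarrow> Q e = Zero"
proof -
  have *: "B e = Zero" if "A \<in> topes L" "B \<in> topes L" "A e = Zero" for A B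
  proof -
    have "compose_sv A B \<in> L" "A \<le> compose_sv A B"
      using that composition by (auto simp: topes_def compose_sv_def le_fun_def less_eq_sign_def)
    then have "compose_sv A B = A" using that(1) by (auto simp: topes_def)
    then have "compose_sv A B e = A e" by simp
    with that(3) show ?thesis by (simp add: compose_sv_def)
  qed
  from *[OF assms] *[OF assms(2,1)] show ?thesis by blast
qed

lemma tope_poset_partial_order:
  assumes R: "R \<in> topes L"
  shows "partial_order_on (topes L) (tope_poset L R)"
proof -
  have "P = Q" if "(P, Q) \<in> tope_poset L R" "(Q, P) \<in> tope_poset L R" for P Q
  proof
    fix e
    have T: "P \<in> topes L" "Q \<in> topes L" and "Sep R P = Sep R Q"
      using that by (auto simp: tope_poset_def)
    then have "e \<in> Sep R P \<longleftrightarrow> e \<in> Sep R Q" by simp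
    with topes_same_support[OF R T(1), of e] topes_same_support[OF R T(2), of e]
    show "P e = Q e"
      by (cases "R e"; cases "P e"; cases "Q e") (auto simp: Sep_def uminus_sign_def)
  qed
  then show ?thesis
    by (auto simp: partial_order_on_def preorder_on_def tope_poset_def
        intro!: refl_onI transI antisymI)
qed

end


section \<open>Contractibility of posets\<close>

text \<open>Abstract simplicial complexes are given by their nonempty simplices.\<close>

definition order_complex :: "'a rel \<Rightarrow> 'a set set" where
  "order_complex r = {C \<in> Chains r. finite C \<and> C \<noteq> {}}"

definition closed_cell :: "'a set \<Rightarrow> ('a \<Rightarrow> real) set" where
  "closed_cell C = {x. (\<forall>v. 0 \<le> x v) \<and> (\<forall>v. v \<notin> C \<longrightarrow> x v = 0) \<and> sum x C = 1}"

text \<open>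
  The points are given by barycentric coordinates and the topology is the weak topology: a set is
  open iff its trace on every closed cell is open in the Euclidean topology of that cell.
\<close>

definition geometric_realization :: "'a set set \<Rightarrow> ('a \<Rightarrow> real) topology" where
  "geometric_realization K = topology (\<lambda>U. U \<subseteq> \<Union>(closed_cell ` K) \<and>
     (\<forall>C\<in>K. openin (top_of_set (closed_cell C)) (U \<inter> closed_cell C)))"

lemma openin_geometric_realization:
  "openin (geometric_realization K) U \<longleftrightarrow> U \<subseteq> \<Union>(closed_cell ` K) \<and>
     (\<forall>C\<in>K. openin (top_of_set (closed_cell C)) (U \<inter> closed_cell C))"
proof -
  have "istopology (\<lambda>U. U \<subseteq> \<Union>(closed_cell ` K) \<and>
     (\<forall>C\<in>K. openin (top_of_set (closed_cell C)) (U \<inter> closed_cell C)))"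
    unfolding istopology_def
  proof (intro conjI allI impI ballI)
    fix S T C
    assume S: "S \<subseteq> \<Union>(closed_cell ` K) \<and>
        (\<forall>C\<in>K. openin (top_of_set (closed_cell C)) (S \<inter> closed_cell C))"
      and T: "T \<subseteq> \<Union>(closed_cell ` K) \<and>
        (\<forall>C\<in>K. openin (top_of_set (closed_cell C)) (T \<inter> closed_cell C))"
    show "S \<inter> T \<subseteq> \<Union>(closed_cell ` K)" using S by blast
    assume "C \<in> K"
    have "S \<inter> T \<inter> closed_cell C = (S \<inter> closed_cell C) \<inter> (T \<inter> closed_cell C)" by blast
    then show "openin (top_of_set (closed_cell C)) (S \<inter> T \<inter> closed_cell C)"
      using S T \<open>C \<in> K\<close> by (metis openin_Int)
  next
    fix F
    assume F: "\<forall>S\<in>F. S \<subseteq> \<Union>(closed_cell ` K) \<and>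
        (\<forall>C\<in>K. openin (top_of_set (closed_cell C)) (S \<inter> closed_cell C))"
    show "\<Union>F \<subseteq> \<Union>(closed_cell ` K)" using F by blast
    fix C
    assume "C \<in> K"
    have "\<Union>F \<inter> closed_cell C = (\<Union>S\<in>F. S \<inter> closed_cell C)" by blast
    moreover have "openin (top_of_set (closed_cell C)) (\<Union>S\<in>F. S \<inter> closed_cell C)"
      using F \<open>C \<in> K\<close> by (intro openin_Union) auto
    ultimately show "openin (top_of_set (closed_cell C)) (\<Union>F \<inter> closed_cell C)" by simp
  qed
  then show ?thesis by (simp add: geometric_realization_def topology_inverse')
qed

lemma topspace_geometric_realization:
  "topspace (geometric_realization K) = \<Union>(closed_cell ` K)"
proof
  show "topspace (geometric_realization K) \<subseteq> \<Union>(closed_cell ` K)"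
    unfolding topspace_def openin_geometric_realization by blast
  have "openin (top_of_set (closed_cell C)) (\<Union>(closed_cell ` K) \<inter> closed_cell C)" if "C \<in> K" for C
  proof -
    have "\<Union>(closed_cell ` K) \<inter> closed_cell C = closed_cell C" using that by blast
    then show ?thesis by simp
  qed
  then show "\<Union>(closed_cell ` K) \<subseteq> topspace (geometric_realization K)"
    by (intro openin_subset) (simp add: openin_geometric_realization)
qed

definition contractible_poset :: "'a rel \<Rightarrow> bool" where
  "contractible_poset r \<longleftrightarrow> contractible_space (geometric_realization (order_complex r))"

end

theory Submission
  imports Defs
begin

text \<open>
  Let \<open>C\<close> be the supertope and \<open>F\<close> the poset, under the componentwise order, of all covectors that
  carry the prescribed signs on \<open>S\<^sup>+ \<union> S\<^sup>-\<close>. Geometrically \<open>F\<close> is the face poset of an open cone cut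
  by hyperplanes and \<open>C\<close> is its set of chambers. Sending a face \<open>X\<close> to the composition \<open>X \<circ> R\<close>, the
  chamber at \<open>X\<close> nearest to \<open>R\<close>, is an order-preserving map from \<open>F\<close> to \<open>C\<close>, because the elements
  separating \<open>R\<close> from \<open>X \<circ> R\<close> are those where \<open>X\<close> is opposite to \<open>R\<close>. By a fiber theorem in the style
  of Quillen, \<open>C\<close> is contractible once \<open>F\<close> and all fibers \<open>{X \<in> F. X \<circ> R \<preceq> T}\<close> are.

  Both \<open>F\<close> and the fibers are sets of covectors \<open>X\<close> that agree with a sign vector \<open>w\<close> on a set \<open>S\<close> and
  satisfy \<open>X \<le> w\<close> on a set \<open>A\<close> containing \<open>S\<close> (\<open>compose_below_iff\<close>). Such a set, if nonempty, is
  contractible (\<open>poset_extensor_conformal_region\<close>), by induction on the number of elements outside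
  \<open>A\<close>. If \<open>e \<notin> A\<close>, comparable covectors cannot have opposite signs at \<open>e\<close>, so the realization is the
  union of the parts \<open>X e \<le> +\<close> and \<open>X e \<le> -\<close>, which meet in the part \<open>X e = 0\<close>; covector elimination
  makes the intersection nonempty when both signs occur. If \<open>A\<close> is the whole ground set, all members
  are conformal to one another and their composition is a maximum.

  To glue contractible pieces one needs more than contractibility as such: the cofibration property
  of subcomplexes must enter somewhere. Here contractibility is replaced throughout by the property
  of being an absolute extensor for metrizable spaces. For closed pieces this property passes to
  unions with a common intersection having it (\<open>metric_extensor_Un\<close>), it passes to cones
  (\<open>metric_extensor_cone\<close>) and to retracts, and for a metrizable space it implies contractibility
  (\<open>metric_extensor_contractible\<close>). Consequently adding to a finite poset an element whose
  comparable elements form an extensor preserves the property (\<open>poset_extensor_insert\<close>), and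
  applying this along a mapping cylinder gives the fiber theorem (\<open>poset_extensor_fiber\<close>).
\<close>

section \<open>Absolute extensors for metrizable spaces\<close>

text \<open>
  Only test spaces on one type \<open>'z\<close> are considered, since a definition cannot quantify over types. All
  closure properties below leave \<open>'z\<close> unchanged, so it can be chosen at the very end.
\<close>

definition metric_extensor :: "'z itself \<Rightarrow> 'x topology \<Rightarrow> bool" where
  "metric_extensor ty X \<longleftrightarrow> (\<forall>(Z :: 'z topology) A f.
     metrizable_space Z \<longrightarrow> closedin Z A \<longrightarrow> continuous_map (subtopology Z A) X f \<longrightarrow>
     (\<exists>g. continuous_map Z X g \<and> (\<forall>a\<in>A. g a = f a)))"

lemma metric_extensorD:
  fixes Z :: "'z topology"
  assumes "metric_extensor TYPE('z) X" "metrizable_space Z"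
    and "closedin (subtopology Z W) A" "continuous_map (subtopology Z A) X f"
  obtains g where "continuous_map (subtopology Z W) X g" "\<And>a. a \<in> A \<Longrightarrow> g a = f a"
proof -
  have "A \<subseteq> W" using assms(3) by (simp add: closedin_imp_subset)
  then have "subtopology (subtopology Z W) A = subtopology Z A"
    by (simp add: subtopology_subtopology Int_absorb1)
  then have f: "continuous_map (subtopology (subtopology Z W) A) X f" using assms(4) by simp
  have "metrizable_space (subtopology Z W)" using assms(2) by (rule metrizable_space_subtopology)
  from assms(1)[unfolded metric_extensor_def, rule_format, OF this assms(3) f]
  show ?thesis using that by blast
qed

text \<open>
  Extending the empty map over a nonempty space produces a point.
\<close>

lemma metric_extensor_nonempty:
  assumes "metric_extensor TYPE('z) X"
  shows "topspace X \<noteq> {}"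
proof -
  have "metrizable_space (discrete_topology (UNIV :: 'z set))"
    by (simp add: metrizable_space_discrete_topology)
  then obtain g :: "'z \<Rightarrow> 'a" where "continuous_map (subtopology (discrete_topology UNIV) UNIV) X g"
    using metric_extensorD[OF assms, of "discrete_topology UNIV" UNIV "{}" "\<lambda>_. undefined"]
    by (auto simp: continuous_map_on_empty)
  then show ?thesis by (auto simp: continuous_map_def)
qed

lemma continuous_map_paste_closed:
  assumes "closedin Z A" "closedin Z B"
    and f: "continuous_map (subtopology Z A) Y f" and g: "continuous_map (subtopology Z B) Y g"
    and agree: "\<And>z. z \<in> A \<Longrightarrow> z \<in> B \<Longrightarrow> f z = g z"
  shows "continuous_map (subtopology Z (A \<union> B)) Y (\<lambda>z. if z \<in> A then f z else g z)"
proof -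
  let ?Z = "subtopology Z (A \<union> B)"
  have sub: "subtopology ?Z A = subtopology Z A" "subtopology ?Z B = subtopology Z B"
    by (simp_all add: subtopology_subtopology Int_absorb1)
  show ?thesis
  proof (rule pasting_lemma_closed[where I = "UNIV :: bool set" and
        T = "\<lambda>b. if b then A else B" and f = "\<lambda>b. if b then f else g"])
    show "closedin ?Z (if b then A else B)" for b
      using assms(1,2) by (auto intro: closedin_subset_topspace)
    show "continuous_map (subtopology ?Z (if b then A else B)) Y (if b then f else g)" for b
      using f g sub by (cases b) auto
    show "\<exists>b. b \<in> UNIV \<and> z \<in> (if b then A else B) \<and>
        (if z \<in> A then f z else g z) = (if b then f else g) z" if "z \<in> topspace ?Z" for z
      using that by (cases "z \<in> A") (auto intro: exI[of _ True] exI[of _ False])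
  qed (auto simp: agree split: if_splits)
qed

text \<open>
  Outside \<open>A \<inter> B\<close> the sets \<open>A\<close> and \<open>B\<close> are disjoint and relatively closed, and this open subspace is
  again metrizable, hence normal. Removing from the space a separating neighbourhood of \<open>B - A\<close>,
  respectively of \<open>A - B\<close>, leaves the two closed pieces.
\<close>

lemma metrizable_closed_splitting:
  assumes "metrizable_space Z" "closedin Z A" "closedin Z B"
  obtains P Q where "closedin Z P" "closedin Z Q" "P \<union> Q = topspace Z"
    "P \<inter> (A \<union> B) = A" "Q \<inter> (A \<union> B) = B"
proof -
  let ?W = "topspace Z - (A \<inter> B)"
  have oW: "openin Z ?W" using assms by (simp add: closedin_Int openin_diff)
  have AB: "A \<subseteq> topspace Z" "B \<subseteq> topspace Z" using assms by (auto dest: closedin_subset)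
  have "normal_space (subtopology Z ?W)"
    by (simp add: assms(1) metrizable_imp_normal_space metrizable_space_subtopology)
  moreover have "closedin (subtopology Z ?W) (?W \<inter> A)" "closedin (subtopology Z ?W) (?W \<inter> B)"
    using assms by (simp_all add: closedin_subtopology_Int_closed)
  moreover have "disjnt (?W \<inter> A) (?W \<inter> B)" by (auto simp: disjnt_def)
  ultimately have "\<exists>U V. openin (subtopology Z ?W) U \<and> openin (subtopology Z ?W) V \<and>
      ?W \<inter> A \<subseteq> U \<and> ?W \<inter> B \<subseteq> V \<and> disjnt U V"
    by (simp only: normal_space_def)
  then obtain U V where "openin (subtopology Z ?W) U" "openin (subtopology Z ?W) V"
      and UV: "?W \<inter> A \<subseteq> U" "?W \<inter> B \<subseteq> V" "disjnt U V"
    by (elim exE conjE)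
  then have "openin Z U" "openin Z V" using oW openin_trans_full by blast+
  then have "closedin Z (topspace Z - (V - A))" "closedin Z (topspace Z - (U - B))"
    using assms by (simp_all add: closedin_diff openin_diff)
  then show ?thesis
  proof (rule that)
    show "(topspace Z - (V - A)) \<union> (topspace Z - (U - B)) = topspace Z"
      using UV(3) by (auto simp: disjnt_def)
    show "(topspace Z - (V - A)) \<inter> (A \<union> B) = A" "(topspace Z - (U - B)) \<inter> (A \<union> B) = B"
      using UV AB by auto
  qed
qed

text \<open>
  A map \<open>f\<close> on a closed set \<open>A\<close> splits \<open>A\<close> into the closed preimages of \<open>S\<close> and \<open>T\<close>, and a closed splitting
  \<open>P \<union> Q\<close> of the whole test space restricts to it. Extend first over \<open>P \<inter> Q\<close> into \<open>S \<inter> T\<close>; together with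
  \<open>f\<close> this prescribes values on closed subsets of \<open>P\<close> and of \<open>Q\<close>, which extend into \<open>S\<close> and \<open>T\<close>, and the
  two extensions agree on \<open>P \<inter> Q\<close>.
\<close>

lemma metric_extensor_Un:
  assumes S: "closedin X S" and T: "closedin X T" and ST: "S \<union> T = topspace X"
    and eS: "metric_extensor TYPE('z) (subtopology X S)"
    and eT: "metric_extensor TYPE('z) (subtopology X T)"
    and eST: "metric_extensor TYPE('z) (subtopology X (S \<inter> T))"
  shows "metric_extensor TYPE('z) X"
  unfolding metric_extensor_def
proof (intro allI impI)
  fix Z :: "'z topology" and A f
  assume Z: "metrizable_space Z" and A: "closedin Z A" and f: "continuous_map (subtopology Z A) X f"
  have topA: "topspace (subtopology Z A) = A"
    using closedin_subset[OF A] by (simp add: Int_absorb1)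
  define A1 A2 where "A1 = {a \<in> A. f a \<in> S}" and "A2 = {a \<in> A. f a \<in> T}"
  have cl: "closedin Z A1" "closedin Z A2"
    using closedin_continuous_map_preimage[OF f S] closedin_continuous_map_preimage[OF f T]
      closedin_trans_full[OF _ A] unfolding topA A1_def A2_def by blast+
  have A12: "A1 \<union> A2 = A"
    using f ST topA by (auto simp: A1_def A2_def continuous_map_def)
  have fr: "continuous_map (subtopology Z B) (subtopology X U) f" if "B \<subseteq> A" "f ` B \<subseteq> U" for B U
    using continuous_map_from_subtopology[OF f, of B] that
    by (auto simp: subtopology_subtopology Int_absorb1 continuous_map_in_subtopology)
  obtain P Q where PQ: "closedin Z P" "closedin Z Q" "P \<union> Q = topspace Z"
      "P \<inter> A = A1" "Q \<inter> A = A2"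
    using metrizable_closed_splitting[OF Z cl] unfolding A12 by blast
  have "closedin (subtopology Z (P \<inter> Q)) (A1 \<inter> A2)"
    using cl PQ by (intro closedin_subset_topspace) auto
  then obtain h where h: "continuous_map (subtopology Z (P \<inter> Q)) (subtopology X (S \<inter> T)) h"
      "\<And>a. a \<in> A1 \<inter> A2 \<Longrightarrow> h a = f a"
    by (rule metric_extensorD[OF eST Z _ fr]) (auto simp: A1_def A2_def)
  have hr: "continuous_map (subtopology Z (P \<inter> Q)) (subtopology X U) h" if "S \<inter> T \<subseteq> U" for U
    using h(1) that by (auto simp: continuous_map_in_subtopology)
  have step: "\<exists>k. continuous_map (subtopology Z W) (subtopology X U) k \<and>
      (\<forall>z\<in>B. k z = f z) \<and> (\<forall>z\<in>P \<inter> Q. k z = h z)"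
    if BU: "metric_extensor TYPE('z) (subtopology X U)" "closedin Z B" "B \<subseteq> A" "f ` B \<subseteq> U"
      "S \<inter> T \<subseteq> U" "B \<subseteq> W" "P \<inter> Q \<subseteq> W" "B \<inter> (P \<inter> Q) \<subseteq> A1 \<inter> A2" for U B W
  proof -
    let ?k = "\<lambda>z. if z \<in> B then f z else h z"
    have PQc: "closedin Z (P \<inter> Q)" using PQ by blast
    have k: "continuous_map (subtopology Z (B \<union> P \<inter> Q)) (subtopology X U) ?k"
    proof (rule continuous_map_paste_closed[OF BU(2) PQc fr[OF BU(3,4)] hr[OF BU(5)]])
      show "f z = h z" if "z \<in> B" "z \<in> P \<inter> Q" for z
        using h(2)[of z] that subsetD[OF BU(8), of z] by simp
    qed
    have "closedin (subtopology Z W) (B \<union> P \<inter> Q)"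
      using BU PQc by (intro closedin_subset_topspace closedin_Un) auto
    then obtain k where "continuous_map (subtopology Z W) (subtopology X U) k"
        "\<And>a. a \<in> B \<union> P \<inter> Q \<Longrightarrow> k a = ?k a"
      by (rule metric_extensorD[OF BU(1) Z _ k]) blast
    moreover have "f z = h z" if "z \<in> B" "z \<in> P \<inter> Q" for z
      using h(2)[of z] that subsetD[OF BU(8), of z] by simp
    ultimately show ?thesis by (intro exI[of _ k]) auto
  qed
  have sub: "A1 \<subseteq> A" "A2 \<subseteq> A" "f ` A1 \<subseteq> S" "f ` A2 \<subseteq> T" "A1 \<subseteq> P" "A2 \<subseteq> Q"
      "A1 \<inter> (P \<inter> Q) \<subseteq> A1 \<inter> A2" "A2 \<inter> (P \<inter> Q) \<subseteq> A1 \<inter> A2"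
    using PQ(4,5) by (auto simp: A1_def A2_def)
  obtain g1 where g1: "continuous_map (subtopology Z P) (subtopology X S) g1"
      "\<And>z. z \<in> A1 \<Longrightarrow> g1 z = f z" "\<And>z. z \<in> P \<inter> Q \<Longrightarrow> g1 z = h z"
    using step[OF eS cl(1) sub(1,3) Int_lower1 sub(5) Int_lower1 sub(7)] by blast
  obtain g2 where g2: "continuous_map (subtopology Z Q) (subtopology X T) g2"
      "\<And>z. z \<in> A2 \<Longrightarrow> g2 z = f z" "\<And>z. z \<in> P \<inter> Q \<Longrightarrow> g2 z = h z"
    using step[OF eT cl(2) sub(2,4) Int_lower2 sub(6) Int_lower2 sub(8)] by blast
  let ?g = "\<lambda>z. if z \<in> P then g1 z else g2 z"
  have "continuous_map (subtopology Z (P \<union> Q)) X ?g"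
    using g1 g2 by (intro continuous_map_paste_closed PQ) (auto simp: continuous_map_in_subtopology)
  moreover have "?g a = f a" if "a \<in> A" for a
    using that g1(2) g2(2) PQ(4) A12 by auto
  ultimately show "\<exists>g. continuous_map Z X g \<and> (\<forall>a\<in>A. g a = f a)"
    unfolding PQ(3) subtopology_topspace by blast
qed

lemma metric_extensor_retract:
  assumes "metric_extensor TYPE('z) X" "continuous_map Y X s" "continuous_map X Y r"
    and rs: "\<And>y. y \<in> topspace Y \<Longrightarrow> r (s y) = y"
  shows "metric_extensor TYPE('z) Y"
  unfolding metric_extensor_def
proof (intro allI impI)
  fix Z :: "'z topology" and A f
  assume Z: "metrizable_space Z" and A: "closedin Z A" and f: "continuous_map (subtopology Z A) Y f"
  have "continuous_map (subtopology Z A) X (s \<circ> f)" using f assms(2) continuous_map_compose by blast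
  then obtain g where g: "continuous_map Z X g" "\<forall>a\<in>A. g a = (s \<circ> f) a"
    using assms(1) Z A unfolding metric_extensor_def by blast
  have "f a \<in> topspace Y" if "a \<in> A" for a
    using f that closedin_subset[OF A] by (auto simp: continuous_map_def)
  then have "\<forall>a\<in>A. (r \<circ> g) a = f a" using g(2) rs by simp
  then show "\<exists>g. continuous_map Z Y g \<and> (\<forall>a\<in>A. g a = f a)"
    using continuous_map_compose[OF g(1) assms(3)] by blast
qed

text \<open>
  A contraction is an extension over \<open>[0,1] \<times> X\<close> of the map that is the identity at the bottom and
  constant at the top.
\<close>

lemma metric_extensor_contractible:
  fixes X :: "'a topology"
  assumes ext: "metric_extensor TYPE(real \<times> 'a) X" and X: "metrizable_space X"
  shows "contractible_space X"
proof -
  obtain a where a: "a \<in> topspace X" using metric_extensor_nonempty[OF ext] by blast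
  let ?Z = "prod_topology (top_of_set {0..1::real}) X"
  let ?A = "{0} \<times> topspace X" and ?B = "{1} \<times> topspace X"
  have Z: "metrizable_space ?Z"
    using X by (simp add: metrizable_space_prod_topology metrizable_space_subtopology
        metrizable_space_euclidean)
  have "closedin (top_of_set {0..1::real}) {t}" if "t \<in> {0..1}" for t
    using that by (simp add: closed_subset)
  then have cl: "closedin ?Z ?A" "closedin ?Z ?B" by (simp_all add: closedin_prod_Times_iff)
  have "continuous_map (subtopology ?Z (?A \<union> ?B)) X (\<lambda>z. if z \<in> ?A then snd z else a)"
    by (rule continuous_map_paste_closed)
      (use cl a in \<open>auto intro!: continuous_map_from_subtopology continuous_map_snd\<close>)
  then obtain h where h: "continuous_map ?Z X h"
      "\<forall>z\<in>?A \<union> ?B. h z = (if z \<in> ?A then snd z else a)"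
    using ext[unfolded metric_extensor_def, rule_format, OF Z closedin_Un[OF cl]] by blast
  let ?h = "\<lambda>z. if z \<in> topspace ?Z then h z else if fst z = 0 then snd z else a"
  have "continuous_map ?Z X ?h"
    using h(1) by (rule continuous_map_eq) auto
  moreover have "?h (0, x) = x" "?h (1, x) = a" for x
    using h(2) by auto
  ultimately have "homotopic_with (\<lambda>_. True) X X id (\<lambda>_. a)"
    unfolding homotopic_with_def by (intro exI[of _ ?h]) auto
  then show ?thesis unfolding contractible_space_def by blast
qed

lemma continuous_map_into_functions:
  "continuous_map X (top_of_set S) f \<longleftrightarrow>
     (\<forall>u. continuous_map X euclideanreal (\<lambda>x. f x u)) \<and> (\<forall>x\<in>topspace X. f x \<in> S)"
  for f :: "'x \<Rightarrow> 'a \<Rightarrow> real"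
proof -
  have "continuous_map X euclidean f \<longleftrightarrow> (\<forall>u. continuous_map X euclideanreal (\<lambda>x. f x u))"
    by (metis continuous_map_componentwise_UNIV euclidean_product_topology)
  then show ?thesis by (auto simp: continuous_map_in_subtopology)
qed

text \<open>
  The geometric cone in barycentric coordinates: \<open>t\<close> is the weight of the apex \<open>v\<close>. The set is meant for
  points \<open>a\<close> with \<open>a v = 0\<close>.
\<close>

definition cone_over :: "'a \<Rightarrow> ('a \<Rightarrow> real) set \<Rightarrow> ('a \<Rightarrow> real) set" where
  "cone_over v A = {\<lambda>u. if u = v then t else (1 - t) * a u | t a. 0 \<le> t \<and> t \<le> 1 \<and> a \<in> A}"

text \<open>
  The factor \<open>b\<close> is controlled only where \<open>p\<close> is positive; boundedness of \<open>b\<close> makes the product tend to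
  \<open>0\<close> together with \<open>p\<close>.
\<close>

lemma continuous_map_mult_vanishing:
  fixes p b :: "'z \<Rightarrow> real"
  assumes p: "continuous_map Z euclideanreal p"
    and b: "continuous_map (subtopology Z {z \<in> topspace Z. 0 < p z}) euclideanreal b"
    and b01: "\<And>z. z \<in> topspace Z \<Longrightarrow> 0 < p z \<Longrightarrow> 0 \<le> b z \<and> b z \<le> 1"
    and p0: "\<And>z. z \<in> topspace Z \<Longrightarrow> 0 \<le> p z"
  shows "continuous_map Z euclideanreal (\<lambda>z. if 0 < p z then p z * b z else 0)"
    (is "continuous_map Z _ ?k")
proof -
  let ?U = "{z \<in> topspace Z. 0 < p z}"
  have oU: "openin Z ?U" and op: "openin Z {z \<in> topspace Z. p z < c}" for c
    using p by (auto simp: continuous_map_upper_lower_semicontinuous_lt)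
  have tU: "topspace (subtopology Z ?U) = ?U" by auto
  have "continuous_map (subtopology Z ?U) euclideanreal (\<lambda>z. p z * b z)"
    by (rule continuous_map_real_mult[OF continuous_map_from_subtopology[OF p] b])
  then have "openin (subtopology Z ?U) {z \<in> ?U. c < p z * b z}"
      "openin (subtopology Z ?U) {z \<in> ?U. p z * b z < c}" for c
    unfolding continuous_map_upper_lower_semicontinuous_lt tU by blast+
  then have o: "openin Z {z \<in> ?U. c < p z * b z}" "openin Z {z \<in> ?U. p z * b z < c}" for c
    using oU openin_trans_full by blast+
  have k0: "0 \<le> ?k z" if "z \<in> topspace Z" for z using b01[OF that] by simp
  have kp: "?k z \<le> p z" if "z \<in> topspace Z" for z
    using b01[OF that] p0[OF that] by (auto intro: mult_left_le)
  have "openin Z {z \<in> topspace Z. c < ?k z}" for c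
  proof (cases "c < 0")
    case True
    then have eq: "{z \<in> topspace Z. c < ?k z} = topspace Z"
      using k0 by force
    show ?thesis unfolding eq by (rule openin_topspace)
  next
    case False
    then have eq: "{z \<in> topspace Z. c < ?k z} = {z \<in> ?U. c < p z * b z}" by auto
    show ?thesis unfolding eq by (rule o)
  qed
  moreover have "openin Z {z \<in> topspace Z. ?k z < c}" for c
  proof (cases "c \<le> 0")
    case True
    then have eq: "{z \<in> topspace Z. ?k z < c} = {}"
      using k0 by force
    show ?thesis unfolding eq by (rule openin_empty)
  next
    case False
    have "?k z < c \<longleftrightarrow> p z < c \<or> 0 < p z \<and> p z * b z < c" if "z \<in> topspace Z" for z
    proof (cases "0 < p z")
      case True
      then have "p z * b z \<le> p z" using kp[OF that] by (simp only: if_True)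
      then have "p z < c \<Longrightarrow> p z * b z < c" by (rule le_less_trans)
      with True show ?thesis by auto
    qed (use False p0[OF that] in auto)
    then have eq: "{z \<in> topspace Z. ?k z < c} = {z \<in> topspace Z. p z < c} \<union> {z \<in> ?U. p z * b z < c}"
      by blast
    show ?thesis unfolding eq by (intro openin_Un o op)
  qed
  ultimately show ?thesis unfolding continuous_map_upper_lower_semicontinuous_lt by blast
qed

text \<open>
  A map into the cone consists of a height in \<open>[0,1]\<close> and, away from the apex, of a point of the base.
  The height extends by Tietze's theorem. The base point is prescribed on a closed subset of the open
  set where the extended height is below \<open>1\<close>, a metrizable space, and extends there because the base
  is an extensor; near the apex it does not matter, as its weight tends to \<open>0\<close>.
\<close>

lemma metric_extensor_cone:
  fixes A :: "('a \<Rightarrow> real) set"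
  assumes eA: "metric_extensor TYPE('z) (top_of_set A)"
    and apex: "\<And>a. a \<in> A \<Longrightarrow> a v = 0" and unit: "\<And>a u. a \<in> A \<Longrightarrow> 0 \<le> a u \<and> a u \<le> 1"
  shows "metric_extensor TYPE('z) (top_of_set (cone_over v A))"
  unfolding metric_extensor_def
proof (intro allI impI)
  fix Z :: "'z topology" and B f
  assume Z: "metrizable_space Z" and B: "closedin Z B"
    and f: "continuous_map (subtopology Z B) (top_of_set (cone_over v A)) f"
  obtain a0 where a0: "a0 \<in> A" using metric_extensor_nonempty[OF eA] by auto
  have tB: "topspace (subtopology Z B) = B"
    using closedin_subset[OF B] by (simp add: Int_absorb1)
  have fu: "continuous_map (subtopology Z B) euclideanreal (\<lambda>z. f z u)"
    and fB: "\<And>z. z \<in> B \<Longrightarrow> f z \<in> cone_over v A" for u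
    using f unfolding continuous_map_into_functions tB by auto
  have fv: "0 \<le> f z v \<and> f z v \<le> 1" if "z \<in> B" for z
    using fB[OF that] by (auto simp: cone_over_def)
  have base: "(\<lambda>u. if u = v then 0 else f z u / (1 - f z v)) \<in> A" if z: "z \<in> B" "f z v < 1" for z
  proof -
    obtain t a where ta: "f z = (\<lambda>u. if u = v then t else (1 - t) * a u)" "a \<in> A"
      using fB[OF z(1)] by (auto simp: cone_over_def)
    with z(2) have "t < 1" by simp
    with ta apex have "(\<lambda>u. if u = v then 0 else f z u / (1 - f z v)) = a"
      by (intro ext) (auto simp: ta(1))
    with ta show ?thesis by simp
  qed
  obtain h where h: "continuous_map Z euclideanreal h" "h ` topspace Z \<subseteq> {0..1}"
      "\<And>z. z \<in> B \<Longrightarrow> h z = f z v"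
    by (rule Tietze_extension_closed_real_interval[OF metrizable_imp_normal_space[OF Z] B fu, of v 0 1])
      (use fv in auto)
  define p where "p z = 1 - h z" for z
  have p: "continuous_map Z euclideanreal p"
    unfolding p_def using h(1) by (intro continuous_map_diff) auto
  let ?U = "{z \<in> topspace Z. 0 < p z}"
  let ?\<alpha> = "\<lambda>z u. if u = v then 0 else f z u / (1 - f z v)"
  have tUB: "topspace (subtopology Z (?U \<inter> B)) = ?U \<inter> B" by auto
  have "continuous_map (subtopology Z (?U \<inter> B)) (top_of_set A) ?\<alpha>"
    unfolding continuous_map_into_functions
  proof (intro conjI allI ballI)
    have fr: "continuous_map (subtopology Z (?U \<inter> B)) euclideanreal (\<lambda>z. f z u)" for u
      using continuous_map_from_subtopology[OF fu, of ?U]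
      by (simp add: subtopology_subtopology Int_commute)
    show "continuous_map (subtopology Z (?U \<inter> B)) euclideanreal (\<lambda>z. ?\<alpha> z u)" for u
    proof (cases "u = v")
      case False
      have "continuous_map (subtopology Z (?U \<inter> B)) euclideanreal (\<lambda>z. f z u / (1 - f z v))"
        using h(3) by (intro continuous_map_real_divide continuous_map_diff fr)
          (auto simp: p_def)
      with False show ?thesis by simp
    qed simp
    show "?\<alpha> z \<in> A" if "z \<in> topspace (subtopology Z (?U \<inter> B))" for z
      using base that h(3) unfolding tUB by (auto simp: p_def)
  qed
  then obtain \<beta> where \<beta>: "continuous_map (subtopology Z ?U) (top_of_set A) \<beta>"
      "\<And>z. z \<in> ?U \<inter> B \<Longrightarrow> \<beta> z = ?\<alpha> z"
    by (rule metric_extensorD[OF eA Z closedin_subtopology_Int_closed[OF B]]) blast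
  have \<beta>u: "continuous_map (subtopology Z ?U) euclideanreal (\<lambda>z. \<beta> z u)"
    and \<beta>A: "\<And>z. z \<in> ?U \<Longrightarrow> \<beta> z \<in> A" for u
    using \<beta>(1) unfolding continuous_map_into_functions by auto
  let ?g = "\<lambda>z u. if u = v then h z else if 0 < p z then p z * \<beta> z u else 0"
  have "continuous_map Z (top_of_set (cone_over v A)) ?g"
    unfolding continuous_map_into_functions
  proof (intro conjI allI ballI)
    show "continuous_map Z euclideanreal (\<lambda>z. ?g z u)" for u
    proof (cases "u = v")
      case True then show ?thesis using h(1) by simp
    next
      case False
      have "continuous_map Z euclideanreal (\<lambda>z. if 0 < p z then p z * \<beta> z u else 0)"
        using unit[OF \<beta>A] h(2)
        by (intro continuous_map_mult_vanishing[OF p \<beta>u]) (auto simp: p_def)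
      with False show ?thesis by simp
    qed
    show "?g z \<in> cone_over v A" if z: "z \<in> topspace Z" for z
    proof -
      have "h z \<in> {0..1}" using h(2) z by blast
      \<comment> \<open>at the apex the base point has weight \<open>0\<close>, so \<open>a0\<close> may serve\<close>
      moreover have "?g z = (\<lambda>u. if u = v then h z else (1 - h z) * (if 0 < p z then \<beta> z else a0) u)"
        using \<open>h z \<in> {0..1}\<close> by (auto simp: p_def)
      moreover have "(if 0 < p z then \<beta> z else a0) \<in> A" using \<beta>A z a0 by auto
      ultimately show ?thesis unfolding cone_over_def by fastforce
    qed
  qed
  moreover have "?g z = f z" if z: "z \<in> B" for z
  proof
    fix u
    have zZ: "z \<in> topspace Z" using z B closedin_subset by blast
    show "?g z u = f z u"
    proof (cases "u = v \<or> 0 < p z")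
      case True
      then show ?thesis using z zZ h(3) \<beta>(2)[of z] by (auto simp: p_def)
    next
      case False
      then have "f z v = 1" using z fv h(3) by (force simp: p_def)
      then show ?thesis using False fB[OF z] by (auto simp: cone_over_def)
    qed
  qed
  ultimately show "\<exists>g. continuous_map Z (top_of_set (cone_over v A)) g \<and> (\<forall>z\<in>B. g z = f z)"
    by blast
qed

section \<open>Realizations of finite simplicial complexes\<close>

definition realization :: "'a set set \<Rightarrow> ('a \<Rightarrow> real) set" where
  "realization K = \<Union>(closed_cell ` K)"

definition finite_complex :: "'a set set \<Rightarrow> bool" where
  "finite_complex K \<longleftrightarrow> finite K \<and>
     (\<forall>C\<in>K. finite C \<and> C \<noteq> {} \<and> (\<forall>D. D \<subseteq> C \<longrightarrow> D \<noteq> {} \<longrightarrow> D \<in> K))"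

lemma closed_closed_cell: "closed (closed_cell C)"
proof -
  have "closed_cell C = (\<Inter>v. {x. 0 \<le> x v}) \<inter> (\<Inter>v\<in>- C. {x. x v = 0}) \<inter> {x. (\<Sum>v\<in>C. x v) = 1}"
    by (auto simp: closed_cell_def)
  moreover have "continuous_on UNIV (\<lambda>x :: 'a \<Rightarrow> real. \<Sum>v\<in>C. x v)"
    by (intro continuous_intros) simp
  ultimately show ?thesis
    by (auto intro!: closed_Int closed_INT closed_Collect_le closed_Collect_eq continuous_intros)
qed

lemma closed_realization: "finite K \<Longrightarrow> closed (realization K)"
  by (auto simp: realization_def closed_closed_cell intro!: closed_Union)

text \<open>
  For finitely many cells, each of them closed, the weak topology is the topology of pointwise
  convergence of barycentric coordinates.
\<close>

lemma geometric_realization_finite: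
  assumes "finite K"
  shows "geometric_realization K = top_of_set (realization K)"
proof (rule topology_eq[THEN iffD2], intro allI iffI)
  fix U
  assume "openin (geometric_realization K) U"
  then have U: "U \<subseteq> realization K"
      "\<And>C. C \<in> K \<Longrightarrow> openin (top_of_set (closed_cell C)) (U \<inter> closed_cell C)"
    by (auto simp: openin_geometric_realization realization_def)
  have "closed (closed_cell C - U)" if "C \<in> K" for C
  proof -
    have "closed_cell C - U \<inter> closed_cell C = closed_cell C - U" by blast
    then have "closedin (top_of_set (closed_cell C)) (closed_cell C - U)"
      using closedin_diff[OF closedin_topspace U(2)[OF that]] by simp
    then show ?thesis by (simp add: closedin_closed_eq closed_closed_cell)
  qed
  then have "closed (\<Union>C\<in>K. closed_cell C - U)" using assms by (intro closed_UN) auto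
  moreover have "(\<Union>C\<in>K. closed_cell C - U) = realization K - U" by (auto simp: realization_def)
  moreover have "U = realization K - (realization K - U)" using U(1) by blast
  ultimately show "openin (top_of_set (realization K)) U"
    by (metis closed_subset Diff_subset openin_diff openin_subtopology_self)
next
  fix U
  assume "openin (top_of_set (realization K)) U"
  then obtain W where W: "open W" "U = realization K \<inter> W" by (auto simp: openin_open)
  have "U \<inter> closed_cell C = closed_cell C \<inter> W" if "C \<in> K" for C
    using that W(2) by (auto simp: realization_def)
  then show "openin (geometric_realization K) U"
    using W by (auto simp: openin_geometric_realization realization_def openin_open)
qed

lemma closed_cell_unit: "x \<in> closed_cell C \<Longrightarrow> 0 \<le> x u \<and> x u \<le> 1"
proof -
  assume x: "x \<in> closed_cell C"
  then have "finite C" by (auto simp: closed_cell_def intro: ccontr)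
  then have "x u \<le> 1"
    using x member_le_sum[of u C x] by (cases "u \<in> C") (auto simp: closed_cell_def)
  with x show ?thesis by (simp add: closed_cell_def)
qed

lemma closed_cell_support:
  assumes "x \<in> closed_cell C"
  shows "{v. x v \<noteq> 0} \<subseteq> C" "x \<in> closed_cell {v. x v \<noteq> 0}" "{v. x v \<noteq> 0} \<noteq> {}"
proof -
  show sub: "{v. x v \<noteq> 0} \<subseteq> C" using assms by (auto simp: closed_cell_def)
  have "finite C" using assms by (auto simp: closed_cell_def intro: ccontr)
  then have "sum x {v. x v \<noteq> 0} = sum x C"
    using sub by (intro sum.mono_neutral_left) auto
  then show "x \<in> closed_cell {v. x v \<noteq> 0}" using assms by (auto simp: closed_cell_def)
  then have "sum x {v. x v \<noteq> 0} = 1" by (simp add: closed_cell_def)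
  then show "{v. x v \<noteq> 0} \<noteq> {}" by (metis sum.empty zero_neq_one)
qed

text \<open>
  A point determines the unique simplex that contains it in its relative interior. Hence intersections
  of subcomplexes correspond to intersections of their realizations.
\<close>

lemma realization_iff_support:
  assumes "finite_complex K"
  shows "x \<in> realization K \<longleftrightarrow> {v. x v \<noteq> 0} \<in> K \<and> x \<in> closed_cell {v. x v \<noteq> 0}"
proof
  assume "x \<in> realization K"
  then obtain C where C: "C \<in> K" "x \<in> closed_cell C" by (auto simp: realization_def)
  with assms closed_cell_support[OF C(2)]
  show "{v. x v \<noteq> 0} \<in> K \<and> x \<in> closed_cell {v. x v \<noteq> 0}" by (auto simp: finite_complex_def)
qed (auto simp: realization_def)

text \<open>
  The coordinates outside the finite vertex set vanish, so the realization embeds in a finite power of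
  the real line.
\<close>

lemma metrizable_realization:
  fixes K :: "'a set set"
  assumes "finite_complex K"
  shows "metrizable_space (top_of_set (realization K))"
proof -
  let ?V = "\<Union>K"
  have fV: "finite ?V" using assms by (auto simp: finite_complex_def)
  let ?P = "product_topology (\<lambda>_. euclideanreal) ?V"
  let ?r = "\<lambda>x :: 'a \<Rightarrow> real. restrict x ?V" and ?e = "\<lambda>y v. if v \<in> ?V then y v else 0"
  have er: "?e (?r x) = x" if "x \<in> realization K" for x
    using that by (fastforce simp: realization_def closed_cell_def)
  have "homeomorphic_maps (top_of_set (realization K)) (subtopology ?P (?r ` realization K)) ?r ?e"
    unfolding homeomorphic_maps_def
  proof (intro conjI ballI)
    have "continuous_map (top_of_set (realization K)) ?P ?r"
      unfolding continuous_map_componentwise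
    proof (intro conjI ballI)
      fix v
      assume "v \<in> ?V"
      moreover have "continuous_on (realization K) (\<lambda>x. x v)"
        by (rule continuous_on_subset[OF continuous_on_product_coordinates]) simp
      ultimately show "continuous_map (top_of_set (realization K)) euclideanreal (\<lambda>x. ?r x v)"
        by (simp only: restrict_apply if_True continuous_map_iff_continuous)
    qed auto
    then show "continuous_map (top_of_set (realization K)) (subtopology ?P (?r ` realization K)) ?r"
      by (auto simp: continuous_map_in_subtopology)
    show "continuous_map (subtopology ?P (?r ` realization K)) (top_of_set (realization K)) ?e"
      unfolding continuous_map_into_functions
    proof (intro conjI allI ballI)
      show "continuous_map (subtopology ?P (?r ` realization K)) euclideanreal (\<lambda>y. ?e y v)" for v
        by (cases "v \<in> ?V") (auto intro!: continuous_map_from_subtopology continuous_map_product_projection)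
      show "?e y \<in> realization K" if "y \<in> topspace (subtopology ?P (?r ` realization K))" for y
        using that er by auto
    qed
    show "?e (?r x) = x" if "x \<in> topspace (top_of_set (realization K))" for x
      using that er by simp
    show "?r (?e y) = y" if "y \<in> topspace (subtopology ?P (?r ` realization K))" for y
      using that er by auto
  qed
  moreover have "metrizable_space ?P"
  proof -
    have "countable {i \<in> ?V. \<nexists>a :: real. topspace euclideanreal \<subseteq> {a}}"
      by (rule countable_subset[OF _ countable_finite[OF fV]]) blast
    then show ?thesis
      unfolding metrizable_space_product_topology by (simp add: metrizable_space_euclidean)
  qed
  ultimately show ?thesis
    by (meson homeomorphic_maps_imp_homeomorphic_space homeomorphic_metrizable_space
        metrizable_space_subtopology)
qed

abbreviation realization_extensor :: "'z itself \<Rightarrow> 'a set set \<Rightarrow> bool" where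
  "realization_extensor ty K \<equiv> metric_extensor ty (top_of_set (realization K))"

lemma realization_extensor_Un:
  assumes K: "finite_complex K1" "finite_complex K2"
    and e: "realization_extensor TYPE('z) K1" "realization_extensor TYPE('z) K2"
      "realization_extensor TYPE('z) (K1 \<inter> K2)"
  shows "realization_extensor TYPE('z) (K1 \<union> K2)"
proof -
  let ?X = "top_of_set (realization (K1 \<union> K2))"
  have Un: "realization (K1 \<union> K2) = realization K1 \<union> realization K2" by (auto simp: realization_def)
  have "finite_complex (K1 \<inter> K2)" using K by (auto simp: finite_complex_def)
  then have Int: "realization K1 \<inter> realization K2 = realization (K1 \<inter> K2)"
    using K by (auto simp: realization_iff_support)
  have sub: "subtopology ?X S = top_of_set S" if "S \<subseteq> realization (K1 \<union> K2)" for S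
    using that by (simp add: subtopology_subtopology Int_absorb1)
  show ?thesis
  proof (rule metric_extensor_Un)
    show "closedin ?X (realization K1)" "closedin ?X (realization K2)"
      using K by (auto simp: Un finite_complex_def intro!: closed_subset closed_realization)
    show "realization K1 \<union> realization K2 = topspace ?X" using Un by simp
    have "realization K1 \<inter> realization K2 \<subseteq> realization (K1 \<union> K2)" using Un by blast
    then show "metric_extensor TYPE('z) (subtopology ?X (realization K1 \<inter> realization K2))"
      using e(3) sub Int by simp
  qed (use e sub Un in auto)
qed

text \<open>
  The complex on the left consists of \<open>K\<close>, the vertex \<open>v\<close>, and the joins of \<open>v\<close> with simplices of \<open>K\<close>.
\<close>

lemma realization_cone:
  assumes K: "finite_complex K" "K \<noteq> {}" and v: "\<forall>C\<in>K. v \<notin> C"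
  shows "realization (insert {v} (K \<union> insert v ` K)) = cone_over v (realization K)"
proof (intro set_eqI iffI)
  fix x
  assume "x \<in> cone_over v (realization K)"
  then obtain t a C where t: "0 \<le> t" "t \<le> 1" and C: "C \<in> K" "a \<in> closed_cell C"
    and x: "x = (\<lambda>u. if u = v then t else (1 - t) * a u)"
    by (auto simp: cone_over_def realization_def)
  have vC: "v \<notin> C" "finite C" using C K v by (auto simp: finite_complex_def)
  then have "sum x C = (1 - t) * sum a C"
    unfolding x sum_distrib_left by (intro sum.cong) auto
  then have "sum x (insert v C) = 1" using vC C(2) by (simp add: closed_cell_def) (simp add: x)
  then have "x \<in> closed_cell (insert v C)" using C(2) t by (auto simp: closed_cell_def x)
  then show "x \<in> realization (insert {v} (K \<union> insert v ` K))" using C(1) by (auto simp: realization_def)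
next
  fix x
  assume "x \<in> realization (insert {v} (K \<union> insert v ` K))"
  then obtain D where D: "x \<in> closed_cell D" "D \<in> insert {v} (K \<union> insert v ` K)"
    by (auto simp: realization_def)
  from D(2) K obtain C where C: "C \<in> K" "D \<subseteq> insert v C" by auto
  have vC: "v \<notin> C" "finite C" using C K v by (auto simp: finite_complex_def)
  have fD: "finite D" using C vC finite_subset by blast
  have "sum x (insert v C) = sum x D"
    using D(1) C vC by (intro sum.mono_neutral_right) (auto simp: closed_cell_def)
  then have s: "x v + sum x C = 1" using vC D(1) by (simp add: closed_cell_def)
  have pos: "0 \<le> x u" and out: "u \<notin> insert v C \<Longrightarrow> x u = 0" for u
    using D(1) C by (auto simp: closed_cell_def)
  have le: "x v \<le> 1" using closed_cell_unit[OF D(1)] by blast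
  \<comment> \<open>at the apex itself, where the base coordinate is undetermined, any vertex of \<open>C\<close> will do\<close>
  obtain c where c: "c \<in> C" using C(1) K(1) unfolding finite_complex_def by blast
  define a where "a = (if x v < 1 then (\<lambda>u. if u = v then 0 else x u / (1 - x v))
     else (\<lambda>u. if u = c then 1 else 0))"
  have "a \<in> closed_cell C"
  proof (cases "x v < 1")
    case True
    then have a: "a = (\<lambda>u. if u = v then 0 else x u / (1 - x v))" by (simp add: a_def)
    have "sum a C = sum x C / (1 - x v)"
      unfolding a sum_divide_distrib using vC by (intro sum.cong) auto
    then have "sum a C = 1" using s True by simp
    then show ?thesis using pos out True unfolding closed_cell_def a by auto
  next
    case False
    then show ?thesis using c vC by (auto simp: a_def closed_cell_def)
  qed
  moreover have "x = (\<lambda>u. if u = v then x v else (1 - x v) * a u)"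
  proof
    fix u
    show "x u = (if u = v then x v else (1 - x v) * a u)"
    proof (cases "x v < 1")
      case False
      then have "x v = 1" using le by simp
      moreover have "x u = 0" if "u \<noteq> v"
      proof (cases "u \<in> C")
        case True
        then show ?thesis
          using s \<open>x v = 1\<close> pos sum_nonneg_eq_0_iff[OF vC(2), of x] by auto
      qed (use that out in auto)
      ultimately show ?thesis by auto
    qed (auto simp: a_def)
  qed
  ultimately show "x \<in> cone_over v (realization K)"
    using pos le C(1) unfolding cone_over_def realization_def by blast
qed

lemma realization_extensor_cone:
  assumes "finite_complex K" and v: "\<forall>C\<in>K. v \<notin> C" and e: "realization_extensor TYPE('z) K"
  shows "realization_extensor TYPE('z) (insert {v} (K \<union> insert v ` K))"
proof -
  have "K \<noteq> {}" using metric_extensor_nonempty[OF e] by (auto simp: realization_def)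
  moreover have "metric_extensor TYPE('z) (top_of_set (cone_over v (realization K)))"
  proof (rule metric_extensor_cone[OF e])
    show "a v = 0" if "a \<in> realization K" for a
      using that v by (auto simp: realization_def closed_cell_def)
    show "0 \<le> a u \<and> a u \<le> 1" if "a \<in> realization K" for a u
      using that closed_cell_unit[of a _ u] by (auto simp: realization_def)
  qed
  ultimately show ?thesis using realization_cone[OF assms(1) _ v] by simp
qed

lemma realization_extensor_vertex: "realization_extensor TYPE('z) {{v}}"
proof -
  have "closed_cell {v} = {\<lambda>u. if u = v then 1 else 0}" by (auto simp: closed_cell_def)
  then have p: "realization {{v}} = {\<lambda>u. if u = v then 1 else 0}" by (simp add: realization_def)
  show ?thesis
    unfolding metric_extensor_def
  proof (intro allI impI)
    fix Z :: "'z topology" and A f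
    assume A: "closedin Z A"
      and f: "continuous_map (subtopology Z A) (top_of_set (realization {{v}})) f"
    have "f a = (\<lambda>u. if u = v then 1 else 0)" if "a \<in> A" for a
      using f that closedin_subset[OF A] unfolding continuous_map_into_functions p by auto
    then show "\<exists>g. continuous_map Z (top_of_set (realization {{v}})) g \<and> (\<forall>a\<in>A. g a = f a)"
      by (intro exI[of _ "\<lambda>_ u. if u = v then 1 else 0"]) (simp add: p)
  qed
qed

text \<open>
  The affine extension of a vertex map: every vertex passes its weight on to its image.
\<close>

definition pushforward :: "'a set \<Rightarrow> ('a \<Rightarrow> 'b) \<Rightarrow> ('a \<Rightarrow> real) \<Rightarrow> 'b \<Rightarrow> real" where
  "pushforward V \<phi> x = (\<lambda>u. \<Sum>v\<in>{v \<in> V. \<phi> v = u}. x v)"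

lemma continuous_map_pushforward:
  assumes "finite V" "\<Union>K \<subseteq> V" and simp: "\<And>C. C \<in> K \<Longrightarrow> \<phi> ` C \<in> K'"
  shows "continuous_map (top_of_set (realization K)) (top_of_set (realization K')) (pushforward V \<phi>)"
  unfolding continuous_map_into_functions
proof (intro conjI allI ballI)
  show "continuous_map (top_of_set (realization K)) euclideanreal (\<lambda>x. pushforward V \<phi> x u)" for u
    unfolding pushforward_def continuous_map_iff_continuous
    by (intro continuous_on_sum continuous_on_subset[OF continuous_on_product_coordinates]) auto
  fix x
  assume "x \<in> topspace (top_of_set (realization K))"
  then obtain C where C: "C \<in> K" "x \<in> closed_cell C" by (auto simp: realization_def)
  have CV: "C \<subseteq> V" using assms(2) C(1) by blast
  then have fC: "finite C" using assms(1) finite_subset by blast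
  have pf: "pushforward V \<phi> x u = (\<Sum>v\<in>{v \<in> C. \<phi> v = u}. x v)" for u
    unfolding pushforward_def using assms(1) CV C(2)
    by (intro sum.mono_neutral_right) (auto simp: closed_cell_def)
  have "sum (pushforward V \<phi> x) (\<phi> ` C) = sum x C"
    unfolding pf using fC by (simp add: sum.image_gen[of C x \<phi>])
  moreover have "pushforward V \<phi> x u = 0" if "u \<notin> \<phi> ` C" for u
  proof -
    have "{v \<in> C. \<phi> v = u} = {}" using that by auto
    then show ?thesis unfolding pf by (simp only: sum.empty)
  qed
  moreover have "0 \<le> pushforward V \<phi> x u" for u
    unfolding pf using C(2) by (auto simp: closed_cell_def intro: sum_nonneg)
  ultimately have "pushforward V \<phi> x \<in> closed_cell (\<phi> ` C)"
    using C(2) by (auto simp: closed_cell_def)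
  then show "pushforward V \<phi> x \<in> realization K'" using simp[OF C(1)] by (auto simp: realization_def)
qed

lemma realization_extensor_retract:
  assumes K: "finite_complex K" "finite_complex K'" and e: "realization_extensor TYPE('z) K"
    and \<phi>: "\<And>C. C \<in> K \<Longrightarrow> \<phi> ` C \<in> K'" and \<psi>: "\<And>C. C \<in> K' \<Longrightarrow> \<psi> ` C \<in> K"
    and inv: "\<And>v. v \<in> \<Union>K' \<Longrightarrow> \<phi> (\<psi> v) = v"
  shows "realization_extensor TYPE('z) K'"
proof (rule metric_extensor_retract[OF e])
  have fin: "finite (\<Union>K)" "finite (\<Union>K')" using K by (auto simp: finite_complex_def)
  show "continuous_map (top_of_set (realization K')) (top_of_set (realization K)) (pushforward (\<Union>K') \<psi>)"
    "continuous_map (top_of_set (realization K)) (top_of_set (realization K')) (pushforward (\<Union>K) \<phi>)"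
    using fin \<phi> \<psi> by (intro continuous_map_pushforward subset_refl; blast)+
  fix y
  assume "y \<in> topspace (top_of_set (realization K'))"
  then have out: "y w = 0" if "w \<notin> \<Union>K'" for w using that by (auto simp: realization_def closed_cell_def)
  have \<psi>V: "\<psi> w \<in> \<Union>K" if "w \<in> \<Union>K'" for w using \<psi> that by blast
  show "pushforward (\<Union>K) \<phi> (pushforward (\<Union>K') \<psi> y) = y"
  proof
    fix u
    have "pushforward (\<Union>K) \<phi> (pushforward (\<Union>K') \<psi> y) u =
        (\<Sum>v\<in>{v \<in> \<Union>K. \<phi> v = u}. \<Sum>w\<in>{w \<in> {w \<in> \<Union>K'. w = u}. \<psi> w = v}. y w)"
      unfolding pushforward_def
    proof (intro sum.cong refl)
      fix v
      assume "v \<in> {v \<in> \<Union>K. \<phi> v = u}"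
      then have v: "\<phi> v = u" by simp
      have "w = u" if w: "w \<in> \<Union>K'" "\<psi> w = v" for w
        using inv[OF w(1)] v unfolding w(2) by simp
      then show "{w \<in> \<Union>K'. \<psi> w = v} = {w \<in> {w \<in> \<Union>K'. w = u}. \<psi> w = v}" by blast
    qed
    also have "\<dots> = sum y {w \<in> \<Union>K'. w = u}"
    proof (rule sum.group)
      show "finite {w \<in> \<Union>K'. w = u}" by (rule finite_subset[OF _ fin(2)]) blast
      show "finite {v \<in> \<Union>K. \<phi> v = u}" by (rule finite_subset[OF _ fin(1)]) blast
      show "\<psi> ` {w \<in> \<Union>K'. w = u} \<subseteq> {v \<in> \<Union>K. \<phi> v = u}"
      proof (rule image_subsetI)
        fix w
        assume "w \<in> {w \<in> \<Union>K'. w = u}"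
        then have w: "w \<in> \<Union>K'" "w = u" by blast+
        from inv[OF w(1)] \<psi>V[OF w(1)] w(2) show "\<psi> w \<in> {v \<in> \<Union>K. \<phi> v = u}" by simp
      qed
    qed
    also have "{w \<in> \<Union>K'. w = u} = (if u \<in> \<Union>K' then {u} else {})" by auto
    also have "sum y \<dots> = y u" using out by auto
    finally show "pushforward (\<Union>K) \<phi> (pushforward (\<Union>K') \<psi> y) u = y u" .
  qed
qed

section \<open>Finite posets whose realization is an absolute extensor\<close>

definition poset_extensor :: "'z itself \<Rightarrow> 'a rel \<Rightarrow> 'a set \<Rightarrow> bool" where
  "poset_extensor ty r P \<longleftrightarrow> realization_extensor ty (order_complex (Restr r P))"

lemma order_complex_iff:
  "C \<in> order_complex (Restr r P) \<longleftrightarrow>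
     C \<subseteq> P \<and> finite C \<and> C \<noteq> {} \<and> (\<forall>a\<in>C. \<forall>b\<in>C. (a, b) \<in> r \<or> (b, a) \<in> r)"
  by (auto simp: order_complex_def Chains_def)

lemma finite_complex_order_complex:
  assumes "finite P"
  shows "finite_complex (order_complex (Restr r P))"
  unfolding finite_complex_def
proof (intro conjI ballI allI impI)
  have "order_complex (Restr r P) \<subseteq> Pow P" unfolding subset_iff Pow_iff order_complex_iff by blast
  then show "finite (order_complex (Restr r P))" using assms by (simp add: finite_subset)
next
  fix C
  assume C: "C \<in> order_complex (Restr r P)"
  then show "finite C" "C \<noteq> {}" unfolding order_complex_iff by blast+
  fix D
  assume "D \<subseteq> C" "D \<noteq> {}"
  then show "D \<in> order_complex (Restr r P)"
    using C finite_subset[of D C] unfolding order_complex_iff by blast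
qed

text \<open>
  No chain can contain an element of \<open>P - Q\<close> together with one of \<open>Q - P\<close>, so the order complex is the
  union of the two smaller ones.
\<close>

lemma poset_extensor_Un:
  assumes "finite P" "finite Q"
    and "poset_extensor TYPE('z) r P" "poset_extensor TYPE('z) r Q"
      "poset_extensor TYPE('z) r (P \<inter> Q)"
    and sep: "\<And>a b. a \<in> P - Q \<Longrightarrow> b \<in> Q - P \<Longrightarrow> (a, b) \<notin> r \<and> (b, a) \<notin> r"
  shows "poset_extensor TYPE('z) r (P \<union> Q)"
proof -
  have "C \<subseteq> P \<or> C \<subseteq> Q" if "C \<in> order_complex (Restr r (P \<union> Q))" for C
    using that sep unfolding order_complex_iff by blast
  then have Un: "order_complex (Restr r (P \<union> Q)) =
      order_complex (Restr r P) \<union> order_complex (Restr r Q)"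
    unfolding set_eq_iff Un_iff order_complex_iff by blast
  have Int: "order_complex (Restr r (P \<inter> Q)) =
      order_complex (Restr r P) \<inter> order_complex (Restr r Q)"
    unfolding set_eq_iff Int_iff order_complex_iff by blast
  show ?thesis
    using assms(3-5) unfolding poset_extensor_def Un Int
    by (rule realization_extensor_Un[OF finite_complex_order_complex[OF assms(1)]
          finite_complex_order_complex[OF assms(2)]])
qed

lemma poset_extensor_singleton: "(x, x) \<in> r \<Longrightarrow> poset_extensor TYPE('z) r {x}"
proof -
  assume "(x, x) \<in> r"
  then have "order_complex (Restr r {x}) = {{x}}"
    unfolding set_eq_iff order_complex_iff by (auto simp: subset_singleton_iff)
  then show ?thesis unfolding poset_extensor_def by (simp only: realization_extensor_vertex)
qed

text \<open>
  The chains through \<open>x\<close> form the cone with apex \<open>x\<close> over the order complex of the elements comparable to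
  \<open>x\<close>, and this cone meets the order complex of \<open>P\<close> in its base.
\<close>

lemma poset_extensor_insert:
  assumes fin: "finite P" and x: "x \<notin> P" "(x, x) \<in> r" and P: "poset_extensor TYPE('z) r P"
    and link: "poset_extensor TYPE('z) r {y \<in> P. (x, y) \<in> r \<or> (y, x) \<in> r}"
  shows "poset_extensor TYPE('z) r (insert x P)"
proof -
  let ?Q = "{y \<in> P. (x, y) \<in> r \<or> (y, x) \<in> r}"
  let ?K = "\<lambda>P. order_complex (Restr r P)"
  have fc: "finite_complex (?K ?Q)" "finite_complex (?K P)" "finite_complex (?K (insert x ?Q))"
    by (rule finite_complex_order_complex, simp add: fin)+
  have star: "?K (insert x ?Q) = insert {x} (?K ?Q \<union> insert x ` ?K ?Q)"
  proof (intro equalityI subsetI)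
    fix C
    assume C: "C \<in> ?K (insert x ?Q)"
    consider "x \<notin> C" | "C = {x}" | "x \<in> C" "C \<noteq> {x}" by blast
    then show "C \<in> insert {x} (?K ?Q \<union> insert x ` ?K ?Q)"
    proof cases
      case 1
      then have "C \<in> ?K ?Q" using C unfolding order_complex_iff by blast
      then show ?thesis by blast
    next
      case 3
      then have "C - {x} \<in> ?K ?Q" "C = insert x (C - {x})"
        using C unfolding order_complex_iff by blast+
      then show ?thesis by blast
    qed blast
  next
    fix C
    assume "C \<in> insert {x} (?K ?Q \<union> insert x ` ?K ?Q)"
    then consider "C = {x}" | "C \<in> ?K ?Q" | D where "D \<in> ?K ?Q" "C = insert x D" by blast
    then show "C \<in> ?K (insert x ?Q)"
    proof cases
      case 3
      then show ?thesis using x(2) unfolding order_complex_iff by blast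
    qed (use x(2) in \<open>unfold order_complex_iff, blast+\<close>)
  qed
  have "realization_extensor TYPE('z) (?K (insert x ?Q))"
    unfolding star using x(1) link
    by (intro realization_extensor_cone fc) (auto simp: order_complex_iff poset_extensor_def)
  then have starx: "poset_extensor TYPE('z) r (insert x ?Q)" by (simp only: poset_extensor_def)
  have eq: "P \<inter> insert x ?Q = ?Q" "P \<union> insert x ?Q = insert x P" using x(1) by auto
  have "poset_extensor TYPE('z) r (P \<union> insert x ?Q)"
  proof (rule poset_extensor_Un[OF fin _ P starx])
    show "finite (insert x ?Q)" using fin by simp
    show "poset_extensor TYPE('z) r (P \<inter> insert x ?Q)" unfolding eq by (rule link)
  qed auto
  then show ?thesis unfolding eq .
qed

text \<open>
  The order complex is a cone with apex \<open>m\<close>, but over an arbitrary base. The elements other than \<open>m\<close>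
  are therefore added one after the other: \<open>m\<close> is comparable to everything in each link, and links
  have fewer elements.
\<close>

lemma poset_extensor_comparable:
  assumes "finite P" "m \<in> P" and refl: "\<And>x. x \<in> P \<Longrightarrow> (x, x) \<in> r"
    and m: "\<And>x. x \<in> P \<Longrightarrow> (m, x) \<in> r \<or> (x, m) \<in> r"
  shows "poset_extensor TYPE('z) r P"
  using assms
proof (induction "card P" arbitrary: P rule: less_induct)
  case less
  show ?case
  proof (cases "P = {m}")
    case True
    then show ?thesis using less.prems poset_extensor_singleton by metis
  next
    case False
    then obtain x where x: "x \<in> P" "x \<noteq> m" using less.prems by blast
    let ?P = "P - {x}" and ?Q = "{y \<in> P - {x}. (x, y) \<in> r \<or> (y, x) \<in> r}"
    have card: "card ?P < card P" "card ?Q < card P"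
      using x less.prems(1) by (intro psubset_card_mono; auto)+
    have "poset_extensor TYPE('z) r ?P"
      using x less.prems card by (intro less.hyps) auto
    moreover have "poset_extensor TYPE('z) r ?Q"
      using x less.prems card by (intro less.hyps) auto
    ultimately have "poset_extensor TYPE('z) r (insert x ?P)"
      using x less.prems by (intro poset_extensor_insert) auto
    then show ?thesis using x by (simp add: insert_absorb)
  qed
qed

lemma poset_extensor_retract:
  assumes "finite P" "finite Q" and P: "poset_extensor TYPE('z) r P"
    and f: "\<And>a. a \<in> P \<Longrightarrow> f a \<in> Q" "\<And>a b. a \<in> P \<Longrightarrow> b \<in> P \<Longrightarrow> (a, b) \<in> r \<Longrightarrow> (f a, f b) \<in> s"
    and g: "\<And>a. a \<in> Q \<Longrightarrow> g a \<in> P" "\<And>a b. a \<in> Q \<Longrightarrow> b \<in> Q \<Longrightarrow> (a, b) \<in> s \<Longrightarrow> (g a, g b) \<in> r"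
    and fg: "\<And>a. a \<in> Q \<Longrightarrow> f (g a) = a"
  shows "poset_extensor TYPE('z) s Q"
  unfolding poset_extensor_def
proof (rule realization_extensor_retract[OF _ _ P[unfolded poset_extensor_def]])
  show "f ` C \<in> order_complex (Restr s Q)" if "C \<in> order_complex (Restr r P)" for C
    using that f unfolding order_complex_iff by blast
  show "g ` C \<in> order_complex (Restr r P)" if "C \<in> order_complex (Restr s Q)" for C
    using that g unfolding order_complex_iff by blast
  show "f (g v) = v" if "v \<in> \<Union>(order_complex (Restr s Q))" for v
  proof -
    have "v \<in> Q" using that unfolding Union_iff Bex_def order_complex_iff by blast
    then show ?thesis by (rule fg)
  qed
qed (rule finite_complex_order_complex, fact assms)+

lemma finite_maximal:
  assumes "partial_order_on A r" "finite B" "B \<noteq> {}" "B \<subseteq> A"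
  obtains z where "z \<in> B" "\<And>y. y \<in> B \<Longrightarrow> (z, y) \<in> r \<Longrightarrow> y = z"
proof -
  have "\<exists>z\<in>B. \<forall>y\<in>B. (z, y) \<in> r \<longrightarrow> y = z"
    using assms(2-4)
  proof (induction B rule: finite_ne_induct)
    case (insert x B)
    then obtain z where z: "z \<in> B" "\<forall>y\<in>B. (z, y) \<in> r \<longrightarrow> y = z" by auto
    have tr: "trans r" and an: "antisym r" using assms(1) by (auto simp: partial_order_on_def preorder_on_def)
    show ?case
    proof (cases "(z, x) \<in> r")
      case True
      have "y = x" if "y \<in> B" "(x, y) \<in> r" for y
      proof -
        have "y = z" using z(2) that(1) transD[OF tr True that(2)] by blast
        then show ?thesis using antisymD[OF an True] that(2) by blast
      qed
      then show ?thesis by blast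
    qed (use z in blast)
  qed auto
  then show ?thesis using that by blast
qed

text \<open>
  The mapping cylinder of \<open>f\<close>: the source lies below the target, and \<open>a\<close> is below \<open>b\<close> iff \<open>f a\<close> is.
\<close>

definition cylinder_order :: "'a rel \<Rightarrow> ('a \<Rightarrow> 'b) \<Rightarrow> 'b rel \<Rightarrow> ('a + 'b) rel" where
  "cylinder_order r f s =
     {(Inl a, Inl b) | a b. (a, b) \<in> r} \<union> {(Inr a, Inr b) | a b. (a, b) \<in> s} \<union>
     {(Inl a, Inr b) | a b. (f a, b) \<in> s}"

text \<open>
  Build the mapping cylinder from \<open>P\<close> by adding the elements of \<open>Q\<close> in increasing order. The elements
  comparable to a newly added \<open>z\<close> are the fiber over \<open>z\<close> and the elements of \<open>Q\<close> below \<open>z\<close>, which form a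
  partial cylinder of the same kind over that fiber; the claim is therefore proved for all partial
  cylinders at once. Finally the cylinder retracts onto \<open>Q\<close> by \<open>f\<close>.
\<close>

lemma poset_extensor_fiber:
  assumes fin: "finite P" "finite Q"
    and s: "partial_order_on Q s"
    and P: "poset_extensor TYPE('z) r P"
    and f: "\<And>a. a \<in> P \<Longrightarrow> f a \<in> Q" "\<And>a b. a \<in> P \<Longrightarrow> b \<in> P \<Longrightarrow> (a, b) \<in> r \<Longrightarrow> (f a, f b) \<in> s"
    and fiber: "\<And>q. q \<in> Q \<Longrightarrow> poset_extensor TYPE('z) r {a \<in> P. (f a, q) \<in> s}"
  shows "poset_extensor TYPE('z) s Q"
proof -
  let ?c = "cylinder_order r f s"
  have refl: "(q, q) \<in> s" if "q \<in> Q" for q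
    using s that by (auto simp: partial_order_on_def preorder_on_def dest: refl_onD)
  have tr: "trans s" using s by (auto simp: partial_order_on_def preorder_on_def)
  have cyl: "poset_extensor TYPE('z) ?c (Inl ` A \<union> Inr ` D)"
    if "A \<subseteq> P" "poset_extensor TYPE('z) r A" "D \<subseteq> Q"
      and down: "\<And>a b. b \<in> D \<Longrightarrow> a \<in> Q \<Longrightarrow> (a, b) \<in> s \<Longrightarrow> a \<in> D"
      and fib: "\<And>a q. q \<in> D \<Longrightarrow> a \<in> P \<Longrightarrow> (f a, q) \<in> s \<Longrightarrow> a \<in> A" for A D
    using that
  proof (induction "card D" arbitrary: A D rule: less_induct)
    case less
    have fA: "finite A" "finite D" using less.prems(1,3) fin finite_subset by blast+
    show ?case
    proof (cases "D = {}")
      case True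
      have "poset_extensor TYPE('z) ?c (Inl ` A)"
        by (rule poset_extensor_retract[OF _ _ less.prems(2), where f = Inl and
              g = "\<lambda>x. case x of Inl a \<Rightarrow> a | Inr b \<Rightarrow> undefined"])
          (use fA in \<open>auto simp: cylinder_order_def\<close>)
      with True show ?thesis by simp
    next
      case False
      obtain z where z: "z \<in> D" "\<And>y. y \<in> D \<Longrightarrow> (z, y) \<in> s \<Longrightarrow> y = z"
        using finite_maximal[OF s fA(2) False less.prems(3)] by blast
      let ?D = "D - {z}" and ?E = "{y \<in> D - {z}. (y, z) \<in> s}" and ?F = "{a \<in> P. (f a, z) \<in> s}"
      have zQ: "z \<in> Q" using z less.prems(3) by blast
      have card: "card ?D < card D" "card ?E < card D"
        using z(1) fA(2) by (intro psubset_card_mono; auto)+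
      have "poset_extensor TYPE('z) ?c (Inl ` A \<union> Inr ` ?D)"
      proof (rule less.hyps[OF card(1) less.prems(1,2)])
        show "a \<in> ?D" if "b \<in> ?D" "a \<in> Q" "(a, b) \<in> s" for a b
          using that less.prems(4) z by blast
      qed (use less.prems in auto)
      moreover have "poset_extensor TYPE('z) ?c (Inl ` ?F \<union> Inr ` ?E)"
      proof (rule less.hyps[OF card(2) _ fiber[OF zQ]])
        show "a \<in> ?E" if "b \<in> ?E" "a \<in> Q" "(a, b) \<in> s" for a b
          using that less.prems(4) z transD[OF tr, of a b z] by blast
        show "a \<in> ?F" if "q \<in> ?E" "a \<in> P" "(f a, q) \<in> s" for a q
          using that transD[OF tr, of "f a" q z] by blast
      qed (use less.prems(3) in auto)
      moreover have "{y \<in> Inl ` A \<union> Inr ` ?D. (Inr z, y) \<in> ?c \<or> (y, Inr z) \<in> ?c} =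
          Inl ` ?F \<union> Inr ` ?E"
        using less.prems(1,5) z by (auto simp: cylinder_order_def)
      ultimately have "poset_extensor TYPE('z) ?c (insert (Inr z) (Inl ` A \<union> Inr ` ?D))"
        using fA refl[OF zQ]
        by (intro poset_extensor_insert) (auto simp: cylinder_order_def)
      moreover have "insert (Inr z) (Inl ` A \<union> Inr ` ?D) = Inl ` A \<union> Inr ` D" using z(1) by auto
      ultimately show ?thesis by simp
    qed
  qed
  have PQ: "poset_extensor TYPE('z) ?c (Inl ` P \<union> Inr ` Q)"
    by (rule cyl[OF _ P]) auto
  show ?thesis
    by (rule poset_extensor_retract[OF _ _ PQ, where f = "case_sum f (\<lambda>q. q)" and g = Inr])
      (use fin f in \<open>auto simp: cylinder_order_def\<close>)
qed

lemma poset_extensor_contractible: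
  fixes r :: "'a rel"
  assumes "finite P" "poset_extensor TYPE(real \<times> ('a \<Rightarrow> real)) r P"
  shows "contractible_poset (Restr r P)"
proof -
  let ?K = "order_complex (Restr r P)"
  have K: "finite_complex ?K" using assms(1) by (rule finite_complex_order_complex)
  have "contractible_space (top_of_set (realization ?K))"
    using assms(2) metrizable_realization[OF K]
    unfolding poset_extensor_def by (rule metric_extensor_contractible)
  moreover have "geometric_realization ?K = top_of_set (realization ?K)"
    using K by (intro geometric_realization_finite) (simp add: finite_complex_def)
  ultimately show ?thesis by (simp only: contractible_poset_def)
qed

section \<open>Covectors conforming to a sign pattern\<close>

definition covector_order :: "('e \<Rightarrow> sign) rel" where
  "covector_order = {(X, Y). X \<le> Y}"

text \<open>
  The convex regions of the covector poset: in the realizable case, the faces inside an intersection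
  of open half-spaces (\<open>S\<close>), closed half-spaces (\<open>A\<close>) and hyperplanes (where \<open>w\<close> vanishes).
\<close>

definition conformal_region :: "('e \<Rightarrow> sign) set \<Rightarrow> 'e set \<Rightarrow> 'e set \<Rightarrow> ('e \<Rightarrow> sign) \<Rightarrow> ('e \<Rightarrow> sign) set" where
  "conformal_region L S A w = {X \<in> L. (\<forall>e\<in>S. X e = w e) \<and> (\<forall>e\<in>A. X e \<le> w e)}"

context oriented_matroid
begin

lemma finite_covectors: "finite L"
proof (rule finite_subset)
  show "L \<subseteq> {X. \<forall>e. (e \<in> E \<longrightarrow> X e \<in> {Zero, Pos, Neg}) \<and> (e \<notin> E \<longrightarrow> X e = Zero)}"
    using covector_outside sign.exhaust by blast
  show "finite {X. \<forall>e. (e \<in> E \<longrightarrow> X e \<in> {Zero, Pos, Neg}) \<and> (e \<notin> E \<longrightarrow> X e = Zero)}"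
    using finite_ground by (intro finite_set_of_finite_funs) auto
qed

text \<open>
  A maximal element \<open>M\<close> is a maximum: for any other member \<open>X\<close>, the composition of \<open>M\<close> with \<open>X\<close> lies in the
  region above \<open>M\<close>, so it equals \<open>M\<close>, and since \<open>X\<close> and \<open>M\<close> nowhere have opposite signs, \<open>X \<le> M\<close>.
\<close>

lemma conformal_region_full:
  assumes "E \<subseteq> A" "conformal_region L S A w \<noteq> {}"
  shows "poset_extensor TYPE('z) covector_order (conformal_region L S A w)"
proof -
  let ?G = "conformal_region L S A w"
  have fin: "finite ?G" using finite_covectors by (auto simp: conformal_region_def)
  obtain M where M: "M \<in> ?G" "\<And>X. X \<in> ?G \<Longrightarrow> M \<le> X \<Longrightarrow> X = M"
    using finite_has_maximal[OF fin assms(2)] by metis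
  have "X \<le> M" if X: "X \<in> ?G" for X
  proof -
    have c: "M e \<noteq> Zero \<longrightarrow> X e \<le> M e" for e
    proof (cases "e \<in> A")
      case True
      then have "X e \<le> w e" "M e \<le> w e" using X M(1) by (auto simp: conformal_region_def)
      then show ?thesis by (auto simp: less_eq_sign_def)
    next
      case False
      then have "X e = Zero" using X assms(1) covector_outside by (auto simp: conformal_region_def)
      then show ?thesis by (simp add: less_eq_sign_def)
    qed
    have "compose_sv M X \<in> ?G"
      using M(1) X composition by (auto simp: conformal_region_def compose_sv_def)
    moreover have "M \<le> compose_sv M X" by (auto simp: compose_sv_def le_fun_def less_eq_sign_def)
    ultimately have MX: "compose_sv M X = M" by (rule M(2))
    show ?thesis
    proof (rule le_funI)
      fix e
      show "X e \<le> M e" using c[of e] fun_cong[OF MX, of e]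
        by (auto simp: compose_sv_def less_eq_sign_def split: if_splits)
    qed
  qed
  then show ?thesis
    using fin M(1) by (intro poset_extensor_comparable[of _ M]) (auto simp: covector_order_def)
qed

text \<open>
  Eliminating \<open>e\<close> keeps the result inside the region because \<open>X\<close> and \<open>Y\<close> are not separated by any
  element of \<open>A\<close>.
\<close>

lemma conformal_region_eliminate:
  assumes X: "X \<in> conformal_region L S A w" "X e = Pos"
    and Y: "Y \<in> conformal_region L S A w" "Y e = Neg" and A: "S \<subseteq> A" "A \<subseteq> E"
  obtains Z where "Z \<in> conformal_region L S A w" "Z e = Zero"
proof -
  have XY: "X \<in> L" "Y \<in> L" using X Y by (auto simp: conformal_region_def)
  have "e \<in> Sep X Y" using X Y by (simp add: Sep_def uminus_sign_def)
  then obtain Z where Z: "Z \<in> L" "Z e = Zero" "\<forall>f\<in>E - Sep X Y. Z f = compose_sv X Y f"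
    using elimination[OF XY] by blast
  have Zf: "Z f = compose_sv X Y f" if "f \<in> A" for f
  proof -
    have "X f \<le> w f" "Y f \<le> w f" using that X Y by (auto simp: conformal_region_def)
    then have "f \<notin> Sep X Y"
      by (cases "w f") (auto simp: Sep_def less_eq_sign_def uminus_sign_def)
    then show ?thesis using Z(3) that A by blast
  qed
  have "Z \<in> conformal_region L S A w"
    using Zf Z(1) X(1) Y(1) A(1) by (auto simp: conformal_region_def compose_sv_def subset_iff)
  then show ?thesis using Z(2) that by blast
qed

text \<open>
  Cut the region along an element \<open>e\<close> outside \<open>A\<close>. Each of the three parts is again a region, with \<open>e\<close>
  added to \<open>A\<close> and \<open>w\<close> altered at \<open>e\<close>; the value \<open>Zero\<close> there gives the common part.
\<close>

lemma poset_extensor_conformal_region: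
  assumes "S \<subseteq> A" "A \<subseteq> E" "conformal_region L S A w \<noteq> {}"
  shows "poset_extensor TYPE('z) covector_order (conformal_region L S A w)"
  using assms
proof (induction "card (E - A)" arbitrary: A w rule: less_induct)
  case less
  show ?case
  proof (cases "E \<subseteq> A")
    case True
    then show ?thesis using less.prems conformal_region_full by blast
  next
    case False
    then obtain e where e: "e \<in> E" "e \<notin> A" by blast
    let ?G = "conformal_region L S A w"
    let ?H = "\<lambda>t. conformal_region L S (insert e A) (w(e := t))"
    have H: "?H t = {X \<in> ?G. X e \<le> t}" for t
      using e(2) less.prems(1) by (auto simp: conformal_region_def subset_iff)
    have fin: "finite (?H t)" for t using finite_covectors by (simp add: conformal_region_def)
    have "card (E - insert e A) < card (E - A)"
      using e finite_ground by (intro psubset_card_mono) auto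
    then have IH: "poset_extensor TYPE('z) covector_order (?H t)" if "?H t \<noteq> {}" for t
      using less.prems that e by (intro less.hyps) auto
    have le: "t \<le> Pos \<longleftrightarrow> t \<noteq> Neg" "t \<le> Neg \<longleftrightarrow> t \<noteq> Pos" "t \<le> Zero \<longleftrightarrow> t = Zero" for t :: sign
      by (cases t; simp add: less_eq_sign_def)+
    consider (neg) "\<forall>X\<in>?G. X e \<noteq> Pos" | (pos) "\<forall>X\<in>?G. X e \<noteq> Neg"
      | (both) X Y where "X \<in> ?G" "X e = Pos" "Y \<in> ?G" "Y e = Neg"
      by blast
    then show ?thesis
    proof cases
      case neg
      then have "?H Neg = ?G" unfolding H by (auto simp: le)
      then show ?thesis using IH[of Neg] less.prems by simp
    next
      case pos
      then have "?H Pos = ?G" unfolding H by (auto simp: le)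
      then show ?thesis using IH[of Pos] less.prems by simp
    next
      case both
      obtain Z where Z: "Z \<in> ?G" "Z e = Zero"
        using conformal_region_eliminate[OF both less.prems(1,2)] by blast
      have "Z \<in> ?H t" for t unfolding H using Z by (simp add: less_eq_sign_def)
      then have "poset_extensor TYPE('z) covector_order (?H t)" for t using IH by blast
      moreover have "?H Pos \<inter> ?H Neg = ?H Zero" "?H Pos \<union> ?H Neg = ?G"
        unfolding H by (auto simp: le) (metis sign.exhaust)
      moreover have "(X, Y) \<notin> covector_order \<and> (Y, X) \<notin> covector_order"
        if "X \<in> ?H Pos - ?H Neg" "Y \<in> ?H Neg - ?H Pos" for X Y
        using that unfolding H
        by (auto simp: le covector_order_def le_fun_def less_eq_sign_def dest!: spec[of _ e])
      ultimately show ?thesis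
        using poset_extensor_Un[OF fin fin, of covector_order Pos Neg] by metis
    qed
  qed
qed

lemma tope_compose:
  assumes "R \<in> topes L" "X \<in> L"
  shows "compose_sv R X = R"
  using assms composition[of R X]
  by (auto simp: topes_def compose_sv_def le_fun_def less_eq_sign_def)

lemma tope_support:
  assumes "R \<in> topes L" "X \<in> L" "R e = Zero"
  shows "X e = Zero"
  using fun_cong[OF tope_compose[OF assms(1,2)], of e] assms(3) by (simp add: compose_sv_def)

lemma compose_tope:
  assumes "X \<in> L" "R \<in> topes L"
  shows "compose_sv X R \<in> topes L"
proof -
  have "Y = compose_sv X R" if "Y \<in> L" "compose_sv X R \<le> Y" for Y
  proof
    fix e
    show "Y e = compose_sv X R e"
      using le_funD[OF that(2), of e] tope_support[OF assms(2) that(1), of e]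
      by (auto simp: compose_sv_def less_eq_sign_def split: if_splits)
  qed
  then show ?thesis using assms composition by (auto simp: topes_def)
qed

lemma Sep_compose_mono: "X \<le> Y \<Longrightarrow> Sep R (compose_sv X R) \<subseteq> Sep R (compose_sv Y R)"
proof
  fix e
  assume "X \<le> Y" and e: "e \<in> Sep R (compose_sv X R)"
  then have "X e \<le> Y e" by (simp add: le_funD)
  with e show "e \<in> Sep R (compose_sv Y R)"
    by (cases "R e"; cases "X e"; cases "Y e")
      (auto simp: Sep_def compose_sv_def uminus_sign_def less_eq_sign_def)
qed

text \<open>
  The left side describes the fibers of \<open>X \<mapsto> X \<circ> R\<close>; the right side shows that they are conformal
  regions. Where \<open>T\<close> agrees with \<open>R\<close>, the covector \<open>X\<close> must not be opposite to \<open>R\<close>; where \<open>T\<close> is opposite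
  to \<open>R\<close>, nothing is required; where both vanish, so does \<open>X\<close>.
\<close>

lemma compose_below_iff:
  assumes "R \<in> topes L" "T \<in> topes L" "X \<in> L"
  shows "Sep R (compose_sv X R) \<subseteq> Sep R T \<longleftrightarrow> (\<forall>e\<in>E - Sep R T. X e \<le> T e)"
proof -
  have "(e \<in> Sep R (compose_sv X R) \<longrightarrow> e \<in> Sep R T) \<longleftrightarrow> (e \<in> E - Sep R T \<longrightarrow> X e \<le> T e)" for e
    using topes_same_support[OF assms(1,2), of e] tope_support[OF assms(1,3), of e]
      covector_outside[OF assms(3), of e]
    by (cases "e \<in> E"; cases "R e"; cases "X e"; cases "T e")
      (auto simp: Sep_def compose_sv_def uminus_sign_def less_eq_sign_def)
  then show ?thesis by blast
qed

end

section \<open>Contractibility of supertopes\<close>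

theorem theorem1p2:
  fixes E :: "'e set" and L :: "('e \<Rightarrow> sign) set" and R :: "'e \<Rightarrow> sign" and Sp Sm :: "'e set"
  assumes "oriented_matroid E L"
    and "R \<in> topes L"
    and "Sp \<subseteq> E" and "Sm \<subseteq> E"
    and "Sp \<inter> Sm = {}"
    and "Sp \<union> Sm \<noteq> {}"
    and "supertope L Sp Sm \<noteq> {}"
  shows "contractible_poset (Restr (tope_poset L R) (supertope L Sp Sm))"
proof -
  interpret oriented_matroid E L by (rule assms(1))
  let ?C = "supertope L Sp Sm" and ?S = "Sp \<union> Sm"
  define w where "w e = (if e \<in> Sp then Pos else Neg)" for e
  let ?F = "conformal_region L ?S ?S w"
  have w: "(\<forall>e\<in>Sp. X e = Pos) \<and> (\<forall>e\<in>Sm. X e = Neg) \<longleftrightarrow> (\<forall>e\<in>?S. X e = w e)" for X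
    using assms(5) by (auto simp: w_def)
  have F: "?F = {X \<in> L. \<forall>e\<in>?S. X e = w e}" by (auto simp: conformal_region_def)
  have C: "?C = {T \<in> topes L. \<forall>e\<in>?S. T e = w e}"
    using w by (auto simp: supertope_def)
  have CF: "?C \<subseteq> ?F" unfolding C F by (auto simp: topes_def)
  have finF: "finite ?F" using finite_covectors by (simp add: conformal_region_def)
  have finC: "finite ?C" using CF finF by (rule finite_subset)
  have po: "partial_order_on ?C (Restr (tope_poset L R) ?C)"
    using tope_poset_partial_order[OF assms(2)] C
    by (auto simp: partial_order_on_def preorder_on_def tope_poset_def
        intro!: refl_onI transI antisymI dest: antisymD)
  have "poset_extensor TYPE(real \<times> (('e \<Rightarrow> sign) \<Rightarrow> real)) (Restr (tope_poset L R) ?C) ?C"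
  proof (rule poset_extensor_fiber[OF finF finC po, where f = "\<lambda>X. compose_sv X R" and r = covector_order])
    \<comment> \<open>the type is that of the test space \<open>[0,1] \<times> X\<close> for the realization \<open>X\<close> of the supertope\<close>
    show "poset_extensor TYPE(real \<times> (('e \<Rightarrow> sign) \<Rightarrow> real)) covector_order ?F"
      using assms(3,4,7) CF by (intro poset_extensor_conformal_region) auto
    show into: "compose_sv X R \<in> ?C" if "X \<in> ?F" for X
      using that compose_tope[OF _ assms(2)] unfolding F C
      by (auto simp: compose_sv_def w_def)
    show "(compose_sv X R, compose_sv Y R) \<in> Restr (tope_poset L R) ?C"
      if "X \<in> ?F" "Y \<in> ?F" "(X, Y) \<in> covector_order" for X Y
      using into[OF that(1)] into[OF that(2)] Sep_compose_mono[of X Y R] that(3)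
      by (auto simp: tope_poset_def covector_order_def supertope_def)
    show "poset_extensor TYPE(real \<times> (('e \<Rightarrow> sign) \<Rightarrow> real)) covector_order
        {X \<in> ?F. (compose_sv X R, T) \<in> Restr (tope_poset L R) ?C}" if T: "T \<in> ?C" for T
    proof -
      have TT: "T \<in> topes L" "T \<in> L" "\<forall>e\<in>?S. T e = w e" using T unfolding C by (auto simp: topes_def)
      let ?A = "?S \<union> (E - Sep R T)"
      have "{X \<in> ?F. (compose_sv X R, T) \<in> Restr (tope_poset L R) ?C} =
          {X \<in> ?F. Sep R (compose_sv X R) \<subseteq> Sep R T}"
        using into T by (auto simp: tope_poset_def supertope_def)
      also have "\<dots> = conformal_region L ?S ?A T"
        unfolding F conformal_region_def using compose_below_iff[OF assms(2) TT(1)] TT(3) by auto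
      moreover have "T \<in> conformal_region L ?S ?A T" using TT by (auto simp: conformal_region_def)
      ultimately show ?thesis
        using assms(3,4) poset_extensor_conformal_region[of ?S ?A T] by auto
    qed
  qed
  then have "contractible_poset (Restr (Restr (tope_poset L R) ?C) ?C)"
    by (rule poset_extensor_contractible[OF finC])
  moreover have "Restr (Restr (tope_poset L R) ?C) ?C = Restr (tope_poset L R) ?C" by blast
  ultimately show ?thesis by simp
qed

end
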